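(* Let $k\geq 3$. Then, as formal (Laurent) series in $x$ with coefficients polynomial in $p$, $$\sum_{n\geq0}\sum_{\pi\in\mathcal{I}_n(\mathcal{A}_k)}x^np^{\mathrm{fix}(\pi)} =\sum_{j=0}^{k-3}J_j(p)x^j-\frac{x^{k-3}}{2}\Bigl(p+\bigl(p(k-3)x^2-2x-p\bigr)u_0(x)\Bigr)J_{k-2}(p) -\frac{x^{k-4}}{2}\Bigl(x+p-\bigl(x^3(k-3)-px^2(k-1)+x+p\bigr)u_0(x)\Bigr)J_{k-3}(p),$$ where $u_0(x)=1/\sqrt{1-2(k-1)x^2+(k-3)^2x^4}$ (the power series with constant term $1$).
   Context: Permutations are written in one-line notation; $\mathfrak{S}_n$ is the set of permutations of $[n]=\{1,\dots,n\}$. A permutation $\pi\in\mathfrak{S}_n$ contains a pattern $\tau\in\mathfrak{S}_k$ if there are indices $i_1<\dots<i_k$ with $(\pi_{i_1},\dots,\pi_{i_k})$ order-isomorphic to $\tau$; otherwise $\pi$ avoids $\tau$; $\pi$ avoids a set $T$ of patterns if it avoids every $\tau\in T$. An involution is a permutation with $\pi_{\pi_i}=i$ for all $i$; $\mathcal{I}_n$ is the set of involutions of $[n]$ and $\mathcal{I}_n(T)$ those avoiding $T$ ($\mathcal{I}_0$ consists of the empty permutation). $\mathcal{A}_k=\{\sigma\in\mathfrak{S}_k:\sigma_1=1,\sigma_2=2\}$. $\mathrm{fix}(\pi)$ is the number of $i$ with $\pi_i=i$. $J_n(p)=\sum_{\pi\in\mathcal{I}_n}p^{\mathrm{fix}(\pi)}$;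 equivalently $J_0=1$, $J_1=p$, $J_n(p)=pJ_{n-1}(p)+(n-1)J_{n-2}(p)$ for $n\ge2$. *)

theory Defs
  imports "HOL-Computational_Algebra.Formal_Laurent_Series"
begin

text \<open>Permutations of [n] in one-line notation, as lists: the i-th entry (1-based)
  of w is w ! (i - 1).\<close>
definition perms :: "nat \<Rightarrow> nat list set" where
  "perms n = {xs. distinct xs \<and> set xs = {1..n}}"

definition order_iso :: "nat list \<Rightarrow> nat list \<Rightarrow> bool" where
  "order_iso xs ys \<longleftrightarrow> length xs = length ys \<and>
     (\<forall>i<length xs. \<forall>j<length xs. xs ! i < xs ! j \<longleftrightarrow> ys ! i < ys ! j)"

definition contains :: "nat list \<Rightarrow> nat list \<Rightarrow> bool" where
  "contains w tau \<longleftrightarrow> (\<exists>I. I \<subseteq> {..<length w} \<and> card I = length tau \<and> order_iso (nths w I) tau)"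

definition avoids :: "nat list \<Rightarrow> nat list set \<Rightarrow> bool" where
  "avoids w T \<longleftrightarrow> (\<forall>tau\<in>T. \<not> contains w tau)"

definition involutions :: "nat \<Rightarrow> nat list set" where
  "involutions n = {w \<in> perms n. \<forall>i\<in>{1..n}. w ! (w ! (i - 1) - 1) = i}"

definition invols_avoiding :: "nat \<Rightarrow> nat list set \<Rightarrow> nat list set" where
  "invols_avoiding n T = {w \<in> involutions n. avoids w T}"

definition fixpts :: "nat list \<Rightarrow> nat" where
  "fixpts w = card {i \<in> {1..length w}. w ! (i - 1) = i}"

definition A_set :: "nat \<Rightarrow> nat list set" where
  "A_set k = {sigma \<in> perms k. sigma ! 0 = 1 \<and> sigma ! 1 = 2}"

abbreviation pvar :: "real poly" where "pvar \<equiv> [:0, 1:]"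

definition J :: "nat \<Rightarrow> real poly" where
  "J n = (\<Sum>w\<in>involutions n. pvar ^ fixpts w)"

definition u0 :: "nat \<Rightarrow> real poly fps" where
  "u0 k = (THE u. u $ 0 = 1 \<and>
     u ^ 2 * (1 - fps_const (2 * of_nat (k - 1)) * fps_X ^ 2
              + fps_const (of_nat ((k - 3) ^ 2)) * fps_X ^ 4) = 1)"

definition gen_fun :: "nat \<Rightarrow> real poly fps" where
  "gen_fun k = Abs_fps (\<lambda>n. \<Sum>w\<in>invols_avoiding n (A_set k). pvar ^ fixpts w)"

end

theory Submission
  imports Defs
begin

text \<open>
  Put \<open>m = k - 2\<close> and call a point of a permutation high if at least \<open>m\<close> points lie to its
  north-east. A permutation avoids \<open>A_set k\<close> iff no high point is the top of an ascent. Build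
  involutions on finite sets of numbers by inserting a new minimum \<open>a\<close> together with its partner
  \<open>v\<close>. The new points are not north-east of any old one, so the old points keep their status, and
  the insertion is allowed iff \<open>v\<close> exceeds all high points (an involution has equally many points
  to the right of and above its largest high point). Hence the number of values above the largest
  high one governs the process: it goes from \<open>m + d\<close> to \<open>m + d + 1\<close> in \<open>m\<close> ways and to each of
  \<open>m, \<dots>, m + d\<close> in one way. The weights of all continuations satisfy a linear recurrence with
  solution \<open>G\<^sub>d = G\<^sub>0 \<lambda>\<^sup>d\<close>, where \<open>\<lambda>\<close> is the power series root of a quadratic equation. Using them
  as a potential, the generating function telescopes, and only the involutions of sizes \<open>m\<close> and
  \<open>m - 1\<close>, which are all avoiding, remain.
\<close>

section \<open>Removing the smallest point and its partner\<close>

text \<open>Fixing all points outside \<open>S\<close> makes the representing function unique, and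
  turns insertion and removal of a pair into function updates.\<close>

definition invol_on :: "nat set \<Rightarrow> (nat \<Rightarrow> nat) set" where
  "invol_on S = {f. (\<forall>x. f (f x) = x) \<and> (\<forall>x. x \<notin> S \<longrightarrow> f x = x)}"

definition ne_points :: "(nat \<Rightarrow> nat) \<Rightarrow> nat set \<Rightarrow> nat \<Rightarrow> nat set" where
  "ne_points f S i = {j \<in> S. i < j \<and> f i < f j}"

definition high_points :: "nat \<Rightarrow> (nat \<Rightarrow> nat) \<Rightarrow> nat set \<Rightarrow> nat set" where
  "high_points m f S = {i \<in> S. m \<le> card (ne_points f S i)}"

definition no_high_top :: "nat \<Rightarrow> (nat \<Rightarrow> nat) \<Rightarrow> nat set \<Rightarrow> bool" where
  "no_high_top m f S \<longleftrightarrow> (\<forall>i\<in>S. \<forall>j\<in>high_points m f S. \<not> (i < j \<and> f i < f j))"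

text \<open>The offset by \<open>m\<close> loses nothing: by \<open>state_Some\<close> below, at least \<open>m\<close> values exceed the
  largest high one, so the subtraction never truncates.\<close>

definition state :: "nat \<Rightarrow> (nat \<Rightarrow> nat) \<Rightarrow> nat set \<Rightarrow> nat option" where
  "state m f S = (if high_points m f S = {} then None
     else Some (card {x \<in> S. Max (high_points m f S) < x} - m))"

text \<open>The test function \<open>\<phi>\<close> keeps track of the state, so that the recursion
  closes up; the constant 1 gives the coefficients of the generating function.\<close>

definition wsum :: "'a::comm_ring_1 \<Rightarrow> nat \<Rightarrow> nat set \<Rightarrow> (nat option \<Rightarrow> 'a) \<Rightarrow> 'a" where
  "wsum p m S \<phi> =
     (\<Sum>f | f \<in> invol_on S \<and> no_high_top m f S. p ^ card {x \<in> S. f x = x} * \<phi> (state m f S))"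

lemma invol_onD:
  assumes "f \<in> invol_on S"
  shows "f (f x) = x" "x \<notin> S \<Longrightarrow> f x = x" "f x \<in> S \<longleftrightarrow> x \<in> S" "f x = f y \<longleftrightarrow> x = y"
  using assms unfolding invol_on_def by (auto; metis)+

lemma finite_invol_on:
  assumes "finite S" shows "finite (invol_on S)"
proof (rule inj_on_finite)
  \<comment> \<open>The default value 0 off \<open>S\<close> places the functions in a set known to
    be finite; no information is lost, since off \<open>S\<close> they are the identity.\<close>
  let ?r = "\<lambda>f x. if x \<in> S then f x else (0::nat)"
  show "inj_on ?r (invol_on S)"
  proof (rule inj_onI, rule ext)
    fix f g x assume fg: "f \<in> invol_on S" "g \<in> invol_on S" "?r f = ?r g"
    from fun_cong[OF fg(3), of x] show "f x = g x"
      using invol_onD(2)[OF fg(1)] invol_onD(2)[OF fg(2)] by (cases "x \<in> S") auto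
  qed
  show "?r ` invol_on S \<subseteq> {f. \<forall>x. (x \<in> S \<longrightarrow> f x \<in> S) \<and> (x \<notin> S \<longrightarrow> f x = 0)}"
    using invol_onD(3) by auto
  show "finite {f. \<forall>x. (x \<in> S \<longrightarrow> f x \<in> S) \<and> (x \<notin> S \<longrightarrow> f x = (0::nat))}"
    by (rule finite_set_of_finite_funs[OF assms assms])
qed

text \<open>The graph of an involution is symmetric in the diagonal, so \<open>f\<close> maps the
  points north-east of \<open>i\<close> bijectively onto those north-east of
  \<open>f i\<close>.\<close>

lemma image_in_high_points_iff:
  assumes "f \<in> invol_on S"
  shows "f i \<in> high_points m f S \<longleftrightarrow> i \<in> high_points m f S"
proof -
  note F = invol_onD[OF assms]
  have "ne_points f S (f i) = f ` ne_points f S i"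
    unfolding ne_points_def by (auto simp: F image_iff) (metis F)+
  moreover have "inj_on f (ne_points f S i)" by (auto simp: inj_on_def F)
  ultimately show ?thesis by (simp add: high_points_def F card_image)
qed

lemma finite_high_points: "finite S \<Longrightarrow> finite (high_points m f S)"
  by (simp add: high_points_def)

text \<open>All points north-east of the largest high point exceed it, which gives at least
  \<open>m\<close> larger values; the high point itself makes the last inequality strict.\<close>

lemma state_Some:
  assumes "finite S" "state m f S = Some d"
  shows "high_points m f S \<noteq> {}" "card {x \<in> S. Max (high_points m f S) < x} = m + d" "m + d < card S"
proof -
  show ne: "high_points m f S \<noteq> {}" using assms(2) by (auto simp: state_def split: if_splits)
  define h where "h = Max (high_points m f S)"
  have h: "h \<in> high_points m f S" unfolding h_def using ne assms by (intro Max_in finite_high_points)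
  have "h \<in> S" using h by (auto simp: high_points_def)
  have "m \<le> card (ne_points f S h)" using h by (auto simp: high_points_def)
  also have "card (ne_points f S h) \<le> card {x\<in>S. h < x}"
    by (rule card_mono) (use assms in \<open>auto simp: ne_points_def\<close>)
  finally have "m \<le> card {x\<in>S. h < x}" .
  moreover have "d = card {x\<in>S. h < x} - m"
    using assms(2) ne by (simp add: state_def h_def)
  ultimately show *: "card {x \<in> S. Max (high_points m f S) < x} = m + d" by (simp add: h_def)
  have "card {x\<in>S. h < x} < card S"
    by (rule psubset_card_mono) (use assms \<open>h \<in> S\<close> in auto)
  with * show "m + d < card S" by (simp add: h_def)
qed

text \<open>Column \<open>a\<close> is leftmost and row \<open>a\<close> is lowest, so the new
  points are neither north-east of an old point nor tops of ascents. They can only be bottoms of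
  ascents to an old high point \<open>j\<close>, namely if \<open>v < g j\<close> or
  \<open>v < j\<close>; as \<open>g\<close> permutes the high points, both are excluded by requiring
  \<open>v\<close> to exceed all of them. The case \<open>v = a\<close> is a new fixed
  point.\<close>

lemma
  fixes g :: "nat \<Rightarrow> nat"
  assumes a: "a \<in> S" "\<And>x. x \<in> S \<Longrightarrow> a \<le> x" and v: "v \<in> S"
    and g: "g \<in> invol_on (S - {a, v})"
  defines "f \<equiv> g(a := v, v := a)" and "S' \<equiv> S - {a, v}" and "r \<equiv> card {y \<in> S. v < y}"
  shows insert_pair_invol: "f \<in> invol_on S"
    and insert_pair_high_points: "high_points m f S = high_points m g S' \<union> (if m \<le> r then {a, v} else {})"
    and insert_pair_no_high_top: "no_high_top m f S \<longleftrightarrow> no_high_top m g S' \<and> (\<forall>h\<in>high_points m g S'. h < v)"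
proof -
  note G = invol_onD[OF g]
  have ga: "g a = a" "g v = v" using G(2) by auto
  have fS: "f x = g x" if "x \<in> S'" for x using that by (auto simp: f_def S'_def)
  have gS': "g x \<in> S' \<longleftrightarrow> x \<in> S'" for x using G(3) by (simp add: S'_def)
  have fa: "f a = v" "f v = a" by (auto simp: f_def)
  have S: "S = insert a (insert v S')" "a \<notin> S'" "v \<notin> S'" using a v by (auto simp: S'_def)
  have aS': "a < x" if "x \<in> S'" for x using a(2)[of x] that by (auto simp: S'_def)
  have av: "a \<le> v" using a(2) v by simp
  have ff: "f (f x) = x" for x
  proof -
    have "g x \<noteq> a \<and> g x \<noteq> v" if "x \<noteq> a" "x \<noteq> v" using that G(1) ga by metis
    then show ?thesis by (auto simp: f_def G(1))
  qed
  show f: "f \<in> invol_on S"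
    unfolding invol_on_def using ff G(2) a(1) v by (auto simp: f_def)
  note F = invol_onD[OF f]
  have ne_points': "ne_points f S i = ne_points g S' i" if "i \<in> S'" for i
    unfolding ne_points_def using that S aS' av by (auto simp: fS fa gS' not_less dest!: aS'[of "g i"] ) (force simp: fS gS' dest: aS')+
  have "ne_points f S v = {y \<in> S. v < y}"
  proof -
    have "a < f j" if "j \<in> S" "v < j" for j
      using a(2)[of "f j"] that F fa by (metis nat_less_le less_irrefl)
    then show ?thesis by (auto simp: ne_points_def fa)
  qed
  then have NEv: "card (ne_points f S v) = r" by (simp add: r_def)
  have "ne_points f S a = f ` {y \<in> S. v < y}"
  proof -
    have "ne_points f S a = {j \<in> S. v < f j}"
      using av a(2) by (auto simp: ne_points_def fa) (metis F fa nat_less_le less_irrefl)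
    also have "\<dots> = f ` {y \<in> S. v < y}" by (auto simp: F image_iff) (metis F)
    finally show ?thesis .
  qed
  then have NEa: "card (ne_points f S a) = r" by (simp add: r_def card_image inj_on_def F)
  have "high_points m f S = {i \<in> S'. m \<le> card (ne_points f S i)} \<union> {i \<in> {a, v}. m \<le> card (ne_points f S i)}"
    unfolding high_points_def by (subst (1) S) auto
  also have "{i \<in> S'. m \<le> card (ne_points f S i)} = high_points m g S'" by (auto simp: high_points_def ne_points')
  also have "{i \<in> {a, v}. m \<le> card (ne_points f S i)} = (if m \<le> r then {a, v} else {})"
    using NEa NEv by auto
  finally show H: "high_points m f S = high_points m g S' \<union> (if m \<le> r then {a, v} else {})" .
  have sub: "high_points m g S' \<subseteq> S'" by (auto simp: high_points_def)
  have gh: "g j \<in> high_points m g S' \<longleftrightarrow> j \<in> high_points m g S'" for j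
    using image_in_high_points_iff[OF g] by (simp add: S'_def)
  have noa: "\<not> (i < j \<and> f i < f j)" if "i \<in> S" "j \<in> {a, v}" for i j
    using that a(2) F(3) fa by (metis empty_iff insert_iff leD)
  have "no_high_top m f S \<longleftrightarrow> (\<forall>i\<in>S. \<forall>j\<in>high_points m g S'. \<not> (i < j \<and> f i < f j))"
    unfolding no_high_top_def H using noa by (auto split: if_splits)
  also have "\<dots> \<longleftrightarrow> no_high_top m g S' \<and> (\<forall>j\<in>high_points m g S'. \<not> (a < j \<and> v < g j) \<and> \<not> (v < j \<and> a < g j))"
    unfolding no_high_top_def using S sub by (auto simp: fS fa subset_iff)
  also have "(\<forall>j\<in>high_points m g S'. \<not> (a < j \<and> v < g j) \<and> \<not> (v < j \<and> a < g j)) \<longleftrightarrow>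
      (\<forall>j\<in>high_points m g S'. \<not> v < g j \<and> \<not> v < j)"
    using sub aS' gS' by (meson subsetD)
  also have "\<dots> \<longleftrightarrow> (\<forall>j\<in>high_points m g S'. \<not> v < j)" using gh G(1) by metis
  also have "\<dots> \<longleftrightarrow> (\<forall>j\<in>high_points m g S'. j < v)" using sub S(3) by (auto simp: not_less_iff_gr_or_eq)
  finally show "no_high_top m f S \<longleftrightarrow> no_high_top m g S' \<and> (\<forall>h\<in>high_points m g S'. h < v)" .
qed

text \<open>A pair \<open>(a, v)\<close> is inserted, where \<open>a\<close> is the new minimum and \<open>r\<close> points exceed \<open>v\<close>.
  Both new points have exactly \<open>r\<close> points to their north-east.\<close>

definition next_state :: "nat \<Rightarrow> nat \<Rightarrow> nat option \<Rightarrow> nat option" where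
  "next_state m r q = (if m \<le> r then Some (r - m) else map_option Suc q)"

definition allowed :: "nat \<Rightarrow> nat \<Rightarrow> nat option \<Rightarrow> bool" where
  "allowed m r q \<longleftrightarrow> (case q of None \<Rightarrow> True | Some d \<Rightarrow> r \<le> m + d)"

text \<open>If \<open>m + d\<close> old values lie above the largest high point \<open>h\<close>,
  then a partner above \<open>h\<close> has at most these above it, while a partner below
  \<open>h\<close> also has \<open>h\<close> itself above it. A new fixed point lies below
  everything, so it requires that there be no high point.\<close>

lemma insert_pair_allowed:
  assumes fin: "finite S" and a: "\<And>x. x \<in> S \<Longrightarrow> a \<le> x" and v: "v \<in> S"
  defines "S' \<equiv> S - {a, v}" and "r \<equiv> card {y \<in> S. v < y}"
  shows "(\<forall>h\<in>high_points m g S'. h < v) \<longleftrightarrow>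
    (if v = a then state m g S' = None else allowed m r (state m g S'))"
proof (cases "high_points m g S' = {}")
  case True
  then show ?thesis by (auto simp: state_def allowed_def)
next
  case False
  have fin': "finite S'" using fin by (simp add: S'_def)
  define h where "h = Max (high_points m g S')"
  have h: "h \<in> high_points m g S'" "\<And>x. x \<in> high_points m g S' \<Longrightarrow> x \<le> h"
    unfolding h_def using False finite_high_points[OF fin'] by auto
  then have hS: "h \<in> S" "h \<noteq> v" "h \<noteq> a" by (auto simp: S'_def high_points_def)
  obtain d where d: "state m g S' = Some d" using False by (auto simp: state_def)
  have card: "card {x \<in> S'. h < x} = m + d" using state_Some[OF fin' d] by (simp add: h_def)
  have "(\<forall>h\<in>high_points m g S'. h < v) \<longleftrightarrow> h < v" using h by (meson le_less_trans)
  also have "\<dots> \<longleftrightarrow> v \<noteq> a \<and> r \<le> m + d"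
  proof
    assume "h < v"
    then have "{y \<in> S. v < y} \<subseteq> {x \<in> S'. h < x}" using a[OF v] by (auto simp: S'_def)
    then have "r \<le> m + d" unfolding r_def card[symmetric] by (intro card_mono) (use fin' in auto)
    moreover have "v \<noteq> a" using a[OF hS(1)] \<open>h < v\<close> by auto
    ultimately show "v \<noteq> a \<and> r \<le> m + d" by simp
  next
    assume r: "v \<noteq> a \<and> r \<le> m + d"
    show "h < v"
    proof (rule ccontr)
      assume "\<not> h < v"
      then have "v < h" using hS by auto
      then have "insert h {x \<in> S'. h < x} \<subseteq> {y \<in> S. v < y}" using hS by (auto simp: S'_def)
      then have "card (insert h {x \<in> S'. h < x}) \<le> r"
        unfolding r_def by (intro card_mono) (use fin in auto)
      with card fin' r show False by auto
    qed
  qed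
  finally show ?thesis using d by (auto simp: allowed_def)
qed

text \<open>If \<open>m \<le> r\<close>, then \<open>v\<close> becomes the largest high point, with
  \<open>r\<close> values above it. Otherwise the high points stay the same, and \<open>v\<close> is
  one more value above them.\<close>

lemma insert_pair_state:
  fixes g :: "nat \<Rightarrow> nat"
  assumes fin: "finite S" and a: "a \<in> S" "\<And>x. x \<in> S \<Longrightarrow> a \<le> x" and v: "v \<in> S"
    and g: "g \<in> invol_on (S - {a, v})"
  defines "f \<equiv> g(a := v, v := a)" and "S' \<equiv> S - {a, v}" and "r \<equiv> card {y \<in> S. v < y}"
  assumes lt: "\<forall>h\<in>high_points m g S'. h < v"
  shows "state m f S = next_state m r (state m g S')"
proof -
  have fin': "finite S'" using fin by (simp add: S'_def)
  have av: "a \<le> v" using a(2) v by simp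
  note H = insert_pair_high_points[OF a v g, of m, folded f_def S'_def r_def]
  show ?thesis
  proof (cases "m \<le> r")
    case True
    have "Max (high_points m f S) = v"
      using lt True av by (intro Max_eqI finite_high_points fin) (auto simp: H dest: less_imp_le)
    with True show ?thesis by (auto simp: state_def H next_state_def r_def)
  next
    case False
    show ?thesis
    proof (cases "high_points m g S' = {}")
      case True
      with False show ?thesis by (simp add: state_def H next_state_def)
    next
      case ne: False
      define h where "h = Max (high_points m g S')"
      have h: "h \<in> high_points m g S'"
        unfolding h_def using ne finite_high_points[OF fin'] by auto
      then have hS: "h \<in> S" by (auto simp: S'_def high_points_def)
      obtain d where d: "state m g S' = Some d" using ne by (auto simp: state_def)
      have card: "card {x \<in> S'. h < x} = m + d" using state_Some[OF fin' d] by (simp add: h_def)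
      have "{x \<in> S. h < x} = insert v {x \<in> S'. h < x}"
        using lt h a(2)[OF hS] v by (auto simp: S'_def)
      moreover have "v \<notin> {x \<in> S'. h < x}" by (auto simp: S'_def)
      ultimately have "card {x \<in> S. h < x} = Suc (m + d)" using card fin' by simp
      with ne False d show ?thesis by (simp add: state_def H next_state_def h_def)
    qed
  qed
qed

section \<open>Recursion for weighted sums in the partner of the minimum\<close>

lemma remove_pair_invol:
  assumes f: "f \<in> invol_on S" and fa: "f a = v"
  shows "f(a := a, v := v) \<in> invol_on (S - {a, v})" "(f(a := a, v := v))(a := v, v := a) = f"
proof -
  note F = invol_onD[OF f]
  have fv: "f v = a" using F(1)[of a] fa by simp
  have "f x \<noteq> a \<and> f x \<noteq> v" if "x \<noteq> a" "x \<noteq> v" for x using that F(1) fa fv by metis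
  then show "f(a := a, v := v) \<in> invol_on (S - {a, v})"
    unfolding invol_on_def using F by auto
  show "(f(a := a, v := v))(a := v, v := a) = f" using fa fv by auto
qed

text \<open>Inserting and removing the pair are mutually inverse bijections, and only a new fixed
  point contributes a factor \<open>p\<close>.\<close>

lemma wsum_insert_pair:
  assumes fin: "finite S" and a: "a \<in> S" "\<And>x. x \<in> S \<Longrightarrow> a \<le> x" and v: "v \<in> S"
  defines "r \<equiv> card {y \<in> S. v < y}"
  shows "(\<Sum>f | f \<in> invol_on S \<and> no_high_top m f S \<and> f a = v. p ^ card {x \<in> S. f x = x} * \<phi> (state m f S))
    = (if v = a then p else 1) * wsum p m (S - {a, v})
        (\<lambda>q. if (if v = a then q = None else allowed m r q) then \<phi> (next_state m r q) else 0)"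
proof -
  define S' where "S' = S - {a, v}"
  define ok where "ok = (\<lambda>q. if v = a then q = None else allowed m r q)"
  have fin': "finite S'" using fin by (simp add: S'_def)
  have fix_card: "p ^ card {x \<in> S. (g(a := v, v := a)) x = x}
      = (if v = a then p else 1) * p ^ card {x \<in> S'. g x = x}" for g :: "nat \<Rightarrow> nat"
  proof (cases "v = a")
    case True
    have "{x \<in> S. (g(a := v, v := a)) x = x} = insert a {x \<in> S'. g x = x}"
      using True a by (auto simp: S'_def)
    moreover have "a \<notin> {x \<in> S'. g x = x}" by (simp add: S'_def)
    ultimately show ?thesis using fin' True by simp
  next
    case False
    then have "{x \<in> S. (g(a := v, v := a)) x = x} = {x \<in> S'. g x = x}"
      by (auto simp: S'_def)
    with False show ?thesis by simp
  qed
  have no_high_top_iff: "no_high_top m (g(a := v, v := a)) S \<longleftrightarrow> no_high_top m g S' \<and> ok (state m g S')"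
    and state_eq: "ok (state m g S') \<Longrightarrow> state m (g(a := v, v := a)) S = next_state m r (state m g S')"
    if "g \<in> invol_on S'" for g
    using insert_pair_no_high_top[OF a v, of g m] insert_pair_allowed[OF fin a(2) v, of m g]
      insert_pair_state[OF fin a v, of g m] that
    unfolding S'_def ok_def r_def by simp_all
  have "(\<Sum>f | f \<in> invol_on S \<and> no_high_top m f S \<and> f a = v. p ^ card {x \<in> S. f x = x} * \<phi> (state m f S))
    = (\<Sum>g | g \<in> invol_on S' \<and> no_high_top m g S' \<and> ok (state m g S').
        (if v = a then p else 1) * p ^ card {x \<in> S'. g x = x} * \<phi> (next_state m r (state m g S')))"
  proof (rule sum.reindex_bij_witness[where i = "\<lambda>g. g(a := v, v := a)" and j = "\<lambda>f. f(a := a, v := v)"];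
      (elim CollectE conjE)?)
    fix f assume f: "f \<in> invol_on S" "no_high_top m f S" "f a = v"
    note R = remove_pair_invol[OF f(1,3), folded S'_def]
    show "(f(a := a, v := v))(a := v, v := a) = f" by (rule R(2))
    have ok: "no_high_top m (f(a := a, v := v)) S' \<and> ok (state m (f(a := a, v := v)) S')"
      using no_high_top_iff[OF R(1)] R(2) f(2) by simp
    with R show "f(a := a, v := v) \<in> {g. g \<in> invol_on S' \<and> no_high_top m g S' \<and> ok (state m g S')}" by simp
    show "(if v = a then p else 1) * p ^ card {x \<in> S'. (f(a := a, v := v)) x = x}
        * \<phi> (next_state m r (state m (f(a := a, v := v)) S'))
      = p ^ card {x \<in> S. f x = x} * \<phi> (state m f S)"
      by (simp only: fix_card[of "f(a := a, v := v)", unfolded R(2)]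
          state_eq[OF R(1) conjunct2[OF ok], unfolded R(2)])
  next
    fix g assume g: "g \<in> invol_on S'" "no_high_top m g S'" "ok (state m g S')"
    have "g a = a" "g v = v" using invol_onD(2)[OF g(1)] by (auto simp: S'_def)
    then show "(g(a := v, v := a))(a := a, v := v) = g" by auto
    show "g(a := v, v := a) \<in> {f. f \<in> invol_on S \<and> no_high_top m f S \<and> f a = v}"
      using no_high_top_iff[OF g(1)] g insert_pair_invol[OF a v, of g] by (simp add: S'_def)
  qed
  \<comment> \<open>Inadmissible involutions are added with value 0, so the condition moves into the
    test function and the sum is a \<open>wsum\<close> again.\<close>
  also have "\<dots> = (\<Sum>g | g \<in> invol_on S' \<and> no_high_top m g S'. (if v = a then p else 1) *
      (p ^ card {x \<in> S'. g x = x} *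
        (if ok (state m g S') then \<phi> (next_state m r (state m g S')) else 0)))"
    using finite_invol_on[OF fin']
    by (intro sum.mono_neutral_cong_left) (auto simp: mult.assoc)
  finally show ?thesis unfolding wsum_def sum_distrib_left S'_def ok_def .
qed

text \<open>The involutions are grouped by the partner \<open>v\<close> of the minimum
  \<open>a\<close>. For \<open>v = a\<close> all other \<open>card S - 1\<close> points exceed
  \<open>v\<close>.\<close>

lemma wsum_rec:
  assumes fin: "finite S" and a: "a \<in> S" "\<And>x. x \<in> S \<Longrightarrow> a \<le> x"
  shows "wsum p m S \<phi> =
    p * wsum p m (S - {a}) (\<lambda>q. if q = None then \<phi> (next_state m (card S - 1) None) else 0) +
    (\<Sum>v\<in>S - {a}. wsum p m (S - {a, v})
      (\<lambda>q. if allowed m (card {y \<in> S. v < y}) q then \<phi> (next_state m (card {y \<in> S. v < y}) q) else 0))"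
proof -
  let ?F = "\<lambda>f. p ^ card {x \<in> S. f x = x} * \<phi> (state m f S)"
  have fI: "finite {f. f \<in> invol_on S \<and> no_high_top m f S}"
    using finite_invol_on[OF fin] by simp
  have "wsum p m S \<phi> = (\<Sum>v\<in>S. \<Sum>f | f \<in> {f. f \<in> invol_on S \<and> no_high_top m f S} \<and> f a = v. ?F f)"
    unfolding wsum_def
    by (rule sum.group[symmetric]) (use fin fI invol_onD(3) a in auto)
  also have "\<dots> = (\<Sum>f | f \<in> invol_on S \<and> no_high_top m f S \<and> f a = a. ?F f) +
      (\<Sum>v\<in>S - {a}. \<Sum>f | f \<in> invol_on S \<and> no_high_top m f S \<and> f a = v. ?F f)"
    by (subst sum.remove[OF fin a(1)]) (simp add: conj_assoc)
  also have "{y \<in> S. a < y} = S - {a}" using a by (auto simp: le_less)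
  then have "card {y \<in> S. a < y} = card S - 1" using a fin by simp
  then have "(\<Sum>f | f \<in> invol_on S \<and> no_high_top m f S \<and> f a = a. ?F f) =
      p * wsum p m (S - {a}) (\<lambda>q. if q = None then \<phi> (next_state m (card S - 1) None) else 0)"
    by (subst wsum_insert_pair[OF fin a a(1)])
      (auto intro!: arg_cong[where f = "\<lambda>\<psi>. p * wsum p m (S - {a}) \<psi>"])
  also have "(\<Sum>v\<in>S - {a}. \<Sum>f | f \<in> invol_on S \<and> no_high_top m f S \<and> f a = v. ?F f) =
     (\<Sum>v\<in>S - {a}. wsum p m (S - {a, v})
      (\<lambda>q. if allowed m (card {y \<in> S. v < y}) q then \<phi> (next_state m (card {y \<in> S. v < y}) q) else 0))"
    by (intro sum.cong refl, subst wsum_insert_pair[OF fin a]) auto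
  finally show ?thesis .
qed

text \<open>Transitions depend on \<open>v\<close> only through its rank from the top; this
  bijection turns sums over partners into sums over ranks.\<close>

lemma bij_betw_card_greater:
  fixes S :: "nat set"
  assumes fin: "finite S" and a: "a \<in> S" "\<And>x. x \<in> S \<Longrightarrow> a \<le> x"
  shows "bij_betw (\<lambda>v. card {y \<in> S. v < y}) (S - {a}) {..<card S - 1}"
proof -
  let ?r = "\<lambda>v. card {y \<in> S. v < y}"
  have less: "?r w < ?r v" if "v \<in> S" "w \<in> S" "v < w" for v w
    by (rule psubset_card_mono) (use fin that in auto)
  have inj: "inj_on ?r (S - {a})"
    by (rule linorder_inj_onI) (use less in \<open>force+\<close>)
  have "{y \<in> S. a < y} = S - {a}" using a by (auto simp: le_less)
  then have "?r a = card S - 1" using a fin by simp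
  then have "?r ` (S - {a}) \<subseteq> {..<card S - 1}"
    using less[OF a(1)] a by (force simp: le_less)
  then have "?r ` (S - {a}) = {..<card S - 1}"
    using a fin by (intro card_subset_eq) (simp_all add: card_image[OF inj])
  with inj show ?thesis by (simp add: bij_betw_def)
qed

section \<open>Linearity of weighted sums and independence of the underlying set\<close>

lemma wsum_sum: "wsum p m S (\<lambda>q. \<Sum>i\<in>I. \<phi> i q) = (\<Sum>i\<in>I. wsum p m S (\<phi> i))"
  unfolding wsum_def by (subst sum.swap) (simp add: sum_distrib_left)

lemma wsum_add: "wsum p m S (\<lambda>q. \<phi> q + \<psi> q) = wsum p m S \<phi> + wsum p m S \<psi>"
  unfolding wsum_def by (simp add: distrib_left sum.distrib)

lemma wsum_cmult: "wsum p m S (\<lambda>q. c * \<phi> q) = c * wsum p m S \<phi>"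
  unfolding wsum_def by (simp add: sum_distrib_left mult_ac)

lemma wsum_cong:
  assumes "finite S" "\<phi> None = \<psi> None" "\<And>d. m + d < card S \<Longrightarrow> \<phi> (Some d) = \<psi> (Some d)"
  shows "wsum p m S \<phi> = wsum p m S \<psi>"
  unfolding wsum_def
proof (intro sum.cong refl)
  fix f
  show "p ^ card {x \<in> S. f x = x} * \<phi> (state m f S) = p ^ card {x \<in> S. f x = x} * \<psi> (state m f S)"
    using assms state_Some(3)[OF assms(1), of m f] by (cases "state m f S") auto
qed

text \<open>The assumption \<open>indep\<close> has the shape of the induction hypothesis in the
  proof that \<open>wsum\<close> depends only on the size of the set; its case \<open>v = a\<close>
  serves the fixed point term.\<close>

lemma wsum_rec_card:
  assumes fin: "finite S" and a: "a \<in> S" "\<And>x. x \<in> S \<Longrightarrow> a \<le> x"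
    and indep: "\<And>v \<phi>. v \<in> S \<Longrightarrow> wsum p m (S - {a, v}) \<phi> = wsum p m {..<card (S - {a, v})} \<phi>"
  shows "wsum p m S \<phi> =
    p * wsum p m {..<card S - 1} (\<lambda>q. if q = None then \<phi> (next_state m (card S - 1) None) else 0) +
    wsum p m {..<card S - 2} (\<lambda>q. \<Sum>r<card S - 1. if allowed m r q then \<phi> (next_state m r q) else 0)"
proof -
  let ?G = "\<lambda>r q. if allowed m r q then \<phi> (next_state m r q) else 0"
  have "(\<Sum>v\<in>S - {a}. wsum p m (S - {a, v}) (?G (card {y \<in> S. v < y}))) =
      (\<Sum>v\<in>S - {a}. wsum p m {..<card S - 2} (?G (card {y \<in> S. v < y})))"
  proof (intro sum.cong refl)
    fix v assume v: "v \<in> S - {a}"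
    then have "card (S - {a, v}) = card S - 2" using a fin by (subst card_Diff_subset) auto
    then show "wsum p m (S - {a, v}) (?G (card {y \<in> S. v < y})) =
        wsum p m {..<card S - 2} (?G (card {y \<in> S. v < y}))"
      using indep[of v] v by simp
  qed
  also have "\<dots> = (\<Sum>r<card S - 1. wsum p m {..<card S - 2} (?G r))"
    by (rule sum.reindex_bij_betw[OF bij_betw_card_greater[OF fin a]])
  finally show ?thesis
    using indep[OF a(1)] a fin by (subst wsum_rec[OF fin a]) (simp_all add: wsum_sum)
qed

lemma wsum_card:
  assumes "finite S"
  shows "wsum p m S \<phi> = wsum p m {..<card S} \<phi>"
  using assms
proof (induction "card S" arbitrary: S \<phi> rule: less_induct)
  case less
  show ?case
  proof (cases "S = {}")
    case True
    then show ?thesis by simp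
  next
    case False
    \<comment> \<open>Stated for every \<open>T\<close> of the size of \<open>S\<close>, so that it
      serves both \<open>S\<close> and the initial segment, whose recursions have the same
      right-hand side.\<close>
    have IH: "wsum p m (T - {b, v}) \<phi>' = wsum p m {..<card (T - {b, v})} \<phi>'"
      if "finite T" "card T = card S" "b \<in> T" for T b v \<phi>'
    proof (rule less.hyps)
      show "card (T - {b, v}) < card S"
        unfolding that(2)[symmetric] by (rule psubset_card_mono) (use that in auto)
    qed (use that in simp)
    have pos: "0 < card S" using False less.prems by (simp add: card_gt_0_iff)
    show ?thesis
      using wsum_rec_card[of S "Min S" p m \<phi>] wsum_rec_card[of "{..<card S}" 0 p m \<phi>]
        IH[of S "Min S"] IH[of "{..<card S}" 0] less.prems False pos
      by (simp cong: if_cong)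
  qed
qed

section \<open>Words and involutions\<close>

definition word :: "nat \<Rightarrow> (nat \<Rightarrow> nat) \<Rightarrow> nat list" where
  "word n f = map (\<lambda>i. Suc (f i)) [0..<n]"

lemma length_word [simp]: "length (word n f) = n"
  by (simp add: word_def)

lemma nth_word [simp]: "i < n \<Longrightarrow> word n f ! i = Suc (f i)"
  by (simp add: word_def)

lemma word_in_involutions:
  assumes "f \<in> invol_on {..<n}"
  shows "word n f \<in> involutions n"
proof -
  note F = invol_onD[OF assms]
  have "distinct (word n f)" by (auto simp: word_def distinct_map inj_on_def F)
  moreover have "set (word n f) = {1..n}"
  proof -
    have "f ` {..<n} = {..<n}" using F(1) F(3) by (metis image_subset_iff subset_antisym subsetI image_eqI)
    then have "set (word n f) = Suc ` {..<n}"
      by (simp add: word_def image_image[symmetric, of Suc f] lessThan_atLeast0)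
    then show ?thesis by (simp add: image_Suc_lessThan)
  qed
  moreover have "word n f ! (word n f ! (i - 1) - 1) = i" if "i \<in> {1..n}" for i
  proof -
    obtain x where x: "i = Suc x" "x < n" using \<open>i \<in> {1..n}\<close> by (cases i) auto
    then have "f x < n" using F(3)[of x] by simp
    with x F(1) show ?thesis by simp
  qed
  ultimately show ?thesis by (simp add: involutions_def perms_def)
qed

lemma bij_betw_word: "bij_betw (word n) (invol_on {..<n}) (involutions n)"
\<comment> \<open>The inverse undoes the shift from 0-based to 1-based values and is the identity
  beyond \<open>n\<close>, as \<open>invol_on\<close> demands.\<close>
proof (rule bij_betw_byWitness[where f' = "\<lambda>w i. if i < n then w ! i - 1 else i"])
  show "word n ` invol_on {..<n} \<subseteq> involutions n" using word_in_involutions by auto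
  show "\<forall>f\<in>invol_on {..<n}. (\<lambda>i. if i < n then word n f ! i - 1 else i) = f"
    using invol_onD(2) by fastforce
  have W: "length w = n" "\<And>i. i < n \<Longrightarrow> w ! i \<in> {1..n}"
    "\<And>i. i < n \<Longrightarrow> w ! (w ! i - 1) = Suc i" if "w \<in> involutions n" for w
  proof -
    have w: "distinct w" "set w = {1..n}" "\<And>i. i \<in> {1..n} \<Longrightarrow> w ! (w ! (i - 1) - 1) = i"
      using that by (auto simp: involutions_def perms_def)
    show l: "length w = n" using distinct_card[OF w(1)] w(2) by simp
    show "w ! i \<in> {1..n}" if "i < n" for i using that l w(2) nth_mem by blast
    show "w ! (w ! i - 1) = Suc i" if "i < n" for i using w(3)[of "Suc i"] that by simp
  qed
  show "\<forall>w\<in>involutions n. word n (\<lambda>i. if i < n then w ! i - 1 else i) = w"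
  proof
    fix w assume w: "w \<in> involutions n"
    show "word n (\<lambda>i. if i < n then w ! i - 1 else i) = w"
      using W(1)[OF w] W(2)[OF w] by (intro nth_equalityI) (auto simp: Suc_le_eq)
  qed
  show "(\<lambda>w i. if i < n then w ! i - 1 else i) ` involutions n \<subseteq> invol_on {..<n}"
  proof clarify
    fix w assume w: "w \<in> involutions n"
    have "w ! i - 1 < n" if "i < n" for i using W(2)[OF w that] by auto
    then show "(\<lambda>i. if i < n then w ! i - 1 else i) \<in> invol_on {..<n}"
      using W(3)[OF w] by (simp add: invol_on_def)
  qed
qed

lemma fixpts_word: "fixpts (word n f) = card {x \<in> {..<n}. f x = x}"
proof -
  have "{i \<in> {1..n}. word n f ! (i - 1) = i} = Suc ` {x \<in> {..<n}. f x = x}"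
  proof (intro set_eqI iffI)
    fix i assume "i \<in> {i \<in> {1..n}. word n f ! (i - 1) = i}"
    then show "i \<in> Suc ` {x \<in> {..<n}. f x = x}" by (intro image_eqI[of _ _ "i - 1"]) auto
  qed auto
  then show ?thesis by (simp add: fixpts_def card_image)
qed

text \<open>Replacing each entry by its rank preserves the order and gives a permutation. This
  produces the pattern formed by a given subsequence.\<close>

lemma standardization:
  assumes "distinct v"
  defines "\<tau> \<equiv> map (\<lambda>x. card {y \<in> set v. y \<le> x}) v"
  shows "\<tau> \<in> perms (length v)" "order_iso v \<tau>"
proof -
  let ?r = "\<lambda>x. card {y \<in> set v. y \<le> x}"
  have less: "?r x < ?r y" if "x < y" "y \<in> set v" for x y
  proof (rule psubset_card_mono)
    have "y \<in> {z \<in> set v. z \<le> y} - {z \<in> set v. z \<le> x}" using that by simp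
    then show "{z \<in> set v. z \<le> x} \<subset> {z \<in> set v. z \<le> y}" using that(1) by fastforce
  qed simp
  have less_iff: "?r x < ?r y \<longleftrightarrow> x < y" if "x \<in> set v" "y \<in> set v" for x y
    using less[of x y] less[of y x] that by (cases x y rule: linorder_cases) auto
  then show "order_iso v \<tau>" by (simp add: order_iso_def \<tau>_def)
  have inj: "inj_on ?r (set v)"
  proof (rule linorder_inj_onI)
    show "?r x \<noteq> ?r y" if "x < y" "y \<in> set v" for x y using less[OF that] by simp
  qed auto
  have "?r x \<in> {1..card (set v)}" if "x \<in> set v" for x
    using that by (auto simp: Suc_le_eq card_gt_0_iff intro!: card_mono)
  then have "?r ` set v = {1..card (set v)}"
    by (intro card_subset_eq) (auto simp: card_image[OF inj])
  then show "\<tau> \<in> perms (length v)"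
    using assms(1) inj by (simp add: perms_def \<tau>_def distinct_map distinct_card)
qed

section \<open>Pattern occurrences and high ascent tops\<close>

lemma nths_eq_map_filter: "nths w I = map ((!) w) (filter (\<lambda>i. i \<in> I) [0..<length w])"
proof -
  have "zip w [0..<length w] = map (\<lambda>i. (w ! i, i)) [0..<length w]"
    by (intro nth_equalityI) auto
  then show ?thesis by (simp add: nths_def filter_map comp_def)
qed

lemma sorted_wrt_less_filter_upt: "sorted_wrt (<) (filter P [0..<n])"
  by (intro sorted_wrt_filter) simp

text \<open>In an occurrence of a pattern beginning 1, 2 the first two entries form an ascent, and
  the remaining \<open>m\<close> entries lie north-east of the second, which is therefore
  high.\<close>

lemma high_top_if_contains:
  assumes \<tau>: "\<tau> \<in> A_set (m + 2)" and c: "contains (word n f) \<tau>"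
  shows "\<not> no_high_top m f {..<n}"
proof -
  have t: "distinct \<tau>" "set \<tau> = {1..m + 2}" "\<tau> ! 0 = 1" "\<tau> ! 1 = 2"
    using \<tau> by (auto simp: A_set_def perms_def)
  have len: "length \<tau> = m + 2" using distinct_card[OF t(1)] t(2) by simp
  obtain I where I: "I \<subseteq> {..<n}" "card I = m + 2" "order_iso (nths (word n f) I) \<tau>"
    using c len by (auto simp: contains_def)
  define L where "L = filter (\<lambda>i. i \<in> I) [0..<n]"
  have nths: "nths (word n f) I = map ((!) (word n f)) L"
    by (simp add: nths_eq_map_filter L_def)
  have lenL: "length L = m + 2" using I(3) len by (simp add: order_iso_def nths)
  have L: "L ! a < n" if "a < m + 2" for a
    using nth_mem[of a L] that lenL by (auto simp: L_def)
  have less: "L ! a < L ! b" if "a < b" "b < m + 2" for a b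
    using sorted_wrt_nth_less[OF sorted_wrt_less_filter_upt[of "\<lambda>i. i \<in> I" n, folded L_def] that(1)]
      that lenL by simp
  have iso: "f (L ! a) < f (L ! b) \<longleftrightarrow> \<tau> ! a < \<tau> ! b" if "a < m + 2" "b < m + 2" for a b
    using I(3) that L lenL by (simp add: order_iso_def nths)
  \<comment> \<open>The values 1 and 2 are taken by the first two positions.\<close>
  have big: "2 < \<tau> ! a" if "2 \<le> a" "a < m + 2" for a
  proof -
    have "\<tau> ! a \<noteq> \<tau> ! 0" "\<tau> ! a \<noteq> \<tau> ! 1"
      using that len t(1) by (auto simp: nth_eq_iff_index_eq)
    moreover have "\<tau> ! a \<in> {1..m + 2}" using nth_mem[of a \<tau>] that len t(2) by simp
    ultimately show ?thesis using t by auto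
  qed
  have "(!) L ` {2..<m + 2} \<subseteq> ne_points f {..<n} (L ! 1)"
    using less[of 1] iso[of 1] L big t by (auto simp: ne_points_def)
  moreover have "inj_on ((!) L) {2..<m + 2}"
    by (rule linorder_inj_onI) (use less in \<open>force+\<close>)
  then have "card ((!) L ` {2..<m + 2}) = m" by (simp add: card_image)
  moreover have "finite (ne_points f {..<n} (L ! 1))" by (simp add: ne_points_def)
  ultimately have "m \<le> card (ne_points f {..<n} (L ! 1))" by (metis card_mono)
  then have "L ! 1 \<in> high_points m f {..<n}" using L[of 1] by (simp add: high_points_def)
  moreover have "L ! 0 < L ! 1" "f (L ! 0) < f (L ! 1)" "L ! 0 \<in> {..<n}"
    using less[of 0 1] iso[of 0 1] L[of 0] t by auto
  ultimately show ?thesis unfolding no_high_top_def by blast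
qed

text \<open>An ascent from \<open>i\<close> to a high point \<open>j\<close>, together with
  \<open>m\<close> points north-east of \<open>j\<close>, standardizes to a pattern beginning 1,
  2.\<close>

lemma contains_if_high_top:
  assumes f: "f \<in> invol_on {..<n}" and "\<not> no_high_top m f {..<n}"
  shows "\<exists>\<tau>\<in>A_set (m + 2). contains (word n f) \<tau>"
proof -
  obtain i j where ij: "i < j" "j < n" "f i < f j" "m \<le> card (ne_points f {..<n} j)"
    using assms(2) by (auto simp: no_high_top_def high_points_def)
  obtain B where B: "B \<subseteq> ne_points f {..<n} j" "card B = m"
    using obtain_subset_with_card_n[OF ij(4)] by blast
  have finB: "finite B" using B by (rule_tac finite_subset[of _ "{..<n}"]) (auto simp: ne_points_def)
  have Bj: "j < x" "f j < f x" "x < n" if "x \<in> B" for x using B(1) that by (auto simp: ne_points_def)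
  define I where "I = insert i (insert j B)"
  have I: "I \<subseteq> {..<n}" "card I = m + 2"
  proof -
    have "i \<notin> B" "j \<notin> B" using ij(1) Bj(1) by (auto dest: less_trans)
    then show "card I = m + 2" using ij(1) B(2) finB by (simp add: I_def)
    show "I \<subseteq> {..<n}" using ij Bj(3) by (auto simp: I_def)
  qed
  have L: "filter (\<lambda>x. x \<in> I) [0..<n] = i # j # sorted_list_of_set B"
  proof (rule strict_sorted_equal)
    show "sorted_wrt (<) (filter (\<lambda>x. x \<in> I) [0..<n])" by (rule sorted_wrt_less_filter_upt)
    show "sorted_wrt (<) (i # j # sorted_list_of_set B)"
      using finB ij(1) Bj(1) by (auto dest: less_trans[OF ij(1)])
    show "set (filter (\<lambda>x. x \<in> I) [0..<n]) = set (i # j # sorted_list_of_set B)"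
      using finB I(1) by (auto simp: I_def)
  qed
  define v where "v = nths (word n f) I"
  have v: "v = Suc (f i) # Suc (f j) # map (\<lambda>x. Suc (f x)) (sorted_list_of_set B)"
    unfolding v_def nths_eq_map_filter using L ij Bj(3) finB by auto
  have dist: "distinct v"
    unfolding v_def using word_in_involutions[OF f] by (simp add: involutions_def perms_def)
  have lenv: "length v = m + 2" using B(2) by (simp add: v)
  define \<tau> where "\<tau> = map (\<lambda>x. card {y \<in> set v. y \<le> x}) v"
  note st = standardization[OF dist, folded \<tau>_def]
  have setv: "set v = insert (Suc (f i)) (insert (Suc (f j)) ((\<lambda>x. Suc (f x)) ` B))"
    using finB by (simp add: v)
  have "f i < f x" if "x \<in> B" for x using Bj(2)[OF that] ij(3) by simp
  then have "{y \<in> set v. y \<le> Suc (f i)} = {Suc (f i)}"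
    using ij(3) unfolding setv by (auto dest: leD)
  moreover have "{y \<in> set v. y \<le> Suc (f j)} = {Suc (f i), Suc (f j)}"
    using ij(3) Bj(2) unfolding setv by (auto dest: leD)
  ultimately have "card {y \<in> set v. y \<le> Suc (f i)} = 1" "card {y \<in> set v. y \<le> Suc (f j)} = 2"
    using ij(3) by simp_all
  then have "\<tau> ! 0 = 1" "\<tau> ! 1 = 2" unfolding \<tau>_def by (simp_all add: v)
  then have "\<tau> \<in> A_set (m + 2)" using st(1) lenv by (simp add: A_set_def)
  moreover have "contains (word n f) \<tau>"
    unfolding contains_def using I st(2) lenv
    by (intro exI[of _ I]) (simp add: \<tau>_def v_def[symmetric])
  ultimately show ?thesis by blast
qed

lemma avoids_word_iff:
  "f \<in> invol_on {..<n} \<Longrightarrow> avoids (word n f) (A_set (m + 2)) \<longleftrightarrow> no_high_top m f {..<n}"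
  using high_top_if_contains contains_if_high_top unfolding avoids_def by blast

lemma sum_invols_avoiding:
  "(\<Sum>w\<in>invols_avoiding n (A_set (m + 2)). p ^ fixpts w) = wsum p m {..<n} (\<lambda>_. 1)"
proof -
  have "inj_on (word n) (invol_on {..<n})" "word n ` invol_on {..<n} = involutions n"
    using bij_betw_word by (auto simp: bij_betw_def)
  moreover have "invols_avoiding n (A_set (m + 2)) =
      word n ` {f. f \<in> invol_on {..<n} \<and> no_high_top m f {..<n}}"
    unfolding invols_avoiding_def calculation(2)[symmetric]
    by (auto simp: avoids_word_iff simp del: add_2_eq_Suc')
  ultimately have "bij_betw (word n) {f. f \<in> invol_on {..<n} \<and> no_high_top m f {..<n}}
      (invols_avoiding n (A_set (m + 2)))"
    by (auto simp: bij_betw_def intro: inj_on_subset)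
  from sum.reindex_bij_betw[OF this, of "\<lambda>w. p ^ fixpts w", symmetric] show ?thesis
    by (simp add: wsum_def fixpts_word)
qed

lemma high_points_empty:
  assumes "finite S" "card S \<le> m"
  shows "high_points m f S = {}"
proof -
  have "card (ne_points f S i) < m" if "i \<in> S" for i
  proof -
    have "card (ne_points f S i) < card S"
      by (rule psubset_card_mono) (use assms that in \<open>auto simp: ne_points_def\<close>)
    with assms show ?thesis by simp
  qed
  then show ?thesis by (force simp: high_points_def)
qed

text \<open>A high point needs \<open>m\<close> further points, so for \<open>n \<le> m\<close>
  every involution is counted, in state \<open>None\<close>.\<close>

lemma wsum_small:
  assumes "n \<le> m"
  shows "wsum p m {..<n} \<phi> = (\<Sum>w\<in>involutions n. p ^ fixpts w) * \<phi> None"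
proof -
  have "high_points m f {..<n} = {}" for f using high_points_empty[of "{..<n}"] assms by simp
  then have "wsum p m {..<n} \<phi> = (\<Sum>f\<in>invol_on {..<n}. p ^ fixpts (word n f) * \<phi> None)"
    by (simp add: wsum_def no_high_top_def state_def fixpts_word)
  also have "\<dots> = (\<Sum>w\<in>involutions n. p ^ fixpts w * \<phi> None)"
    by (rule sum.reindex_bij_betw[OF bij_betw_word])
  finally show ?thesis by (simp add: sum_distrib_right)
qed

section \<open>The generating function\<close>

text \<open>The \<open>m\<close> ranks \<open>r < m\<close> raise the state by one or keep it
  \<open>None\<close>; rank \<open>m + i\<close> leads to \<open>Some i\<close>. A new fixed point
  has rank \<open>Suc n\<close>, which is at least \<open>m\<close>.\<close>

lemma wsum_rec_Suc_Suc:
  assumes "m \<le> Suc n"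
  shows "wsum p m {..<n + 2} \<phi> =
    p * \<phi> (Some (Suc n - m)) * wsum p m {..<Suc n} (\<lambda>q. if q = None then 1 else 0) +
    wsum p m {..<n} (\<lambda>q. case q of
        None \<Rightarrow> of_nat m * \<phi> None + (\<Sum>i<Suc n - m. \<phi> (Some i))
      | Some d \<Rightarrow> of_nat m * \<phi> (Some (Suc d)) + (\<Sum>i<Suc d. \<phi> (Some i)))"
proof -
  let ?G = "\<lambda>q. \<Sum>r<Suc n. if allowed m r q then \<phi> (next_state m r q) else 0"
  have split: "(\<Sum>r<m + b. \<phi> (next_state m r q)) =
      of_nat m * \<phi> (map_option Suc q) + (\<Sum>i<b. \<phi> (Some i))" for b q
  proof -
    have "(\<Sum>r<m + b. \<phi> (next_state m r q)) =
        (\<Sum>r<m. \<phi> (next_state m r q)) + (\<Sum>i<b. \<phi> (next_state m (m + i) q))"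
      by (induction b) (simp_all add: add.assoc)
    then show ?thesis by (simp add: next_state_def)
  qed
  have None: "?G None = of_nat m * \<phi> None + (\<Sum>i<Suc n - m. \<phi> (Some i))"
    using split[where b = "Suc n - m" and q = None] assms by (simp add: allowed_def)
  have Some: "?G (Some d) = of_nat m * \<phi> (Some (Suc d)) + (\<Sum>i<Suc d. \<phi> (Some i))" if "m + d < n" for d
  proof -
    \<comment> \<open>By \<open>m + d < n\<close> all \<open>m + d + 1\<close> allowed ranks occur
      in the sum.\<close>
    have "?G (Some d) = (\<Sum>r<m + Suc d. \<phi> (next_state m r (Some d)))"
      using that by (intro sum.mono_neutral_cong_right) (auto simp: allowed_def)
    then show ?thesis using split[where b = "Suc d" and q = "Some d"] by simp
  qed
  have "wsum p m {..<n + 2} \<phi> =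
      p * wsum p m {..<Suc n} (\<lambda>q. if q = None then \<phi> (next_state m (Suc n) None) else 0) +
      wsum p m {..<n} ?G"
    by (subst wsum_rec_card[of _ 0]) (auto intro!: wsum_card cong: if_cong)
  also have "(\<lambda>q. if q = None then \<phi> (next_state m (Suc n) None) else 0) =
      (\<lambda>q. \<phi> (Some (Suc n - m)) * (if q = None then 1 else 0))"
    using assms by (auto simp: next_state_def)
  also have "wsum p m {..<n} ?G = wsum p m {..<n} (\<lambda>q. case q of
        None \<Rightarrow> of_nat m * \<phi> None + (\<Sum>i<Suc n - m. \<phi> (Some i))
      | Some d \<Rightarrow> of_nat m * \<phi> (Some (Suc d)) + (\<Sum>i<Suc d. \<phi> (Some i)))"
    using None Some by (intro wsum_cong) auto
  finally show ?thesis by (simp add: wsum_cmult mult.assoc)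
qed

text \<open>The total weight of all involutions that arise by further insertions from one in state \<open>q\<close>
  is geometric in the state; for \<open>None\<close> and size \<open>m + d\<close> the exponent is \<open>d\<close>.\<close>

definition potential :: "'a::comm_ring_1 \<Rightarrow> 'a \<Rightarrow> 'a \<Rightarrow> nat \<Rightarrow> nat option \<Rightarrow> 'a" where
  "potential lam g b d q = (case q of None \<Rightarrow> b * lam ^ d | Some i \<Rightarrow> g * lam ^ i)"

text \<open>The third term compensates for the insertion of a fixed point, which raises the size by only
  one: it is already counted in the potential of size \<open>m + d\<close> and again in that of size \<open>m + d + 1\<close>.\<close>

definition tail_series :: "'a::comm_ring_1 \<Rightarrow> nat \<Rightarrow> 'a \<Rightarrow> 'a \<Rightarrow> 'a \<Rightarrow> 'a \<Rightarrow> nat \<Rightarrow> 'a" where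
  "tail_series p m x lam g b d =
     wsum p m {..<m + d} (potential lam g b d) +
     x * wsum p m {..<Suc (m + d)} (potential lam g b (Suc d)) -
     p * x * (g * lam ^ d) * wsum p m {..<m + d} (\<lambda>q. if q = None then 1 else 0)"

text \<open>\<open>lam\<close> is the characteristic root, and \<open>u\<close> inverts minus the
  derivative of its quadratic at \<open>lam\<close>, a square root of the discriminant.
  \<open>g\<close> is the weight of \<open>Some 0\<close>, and \<open>b\<close> that of
  \<open>None\<close> at size \<open>m\<close>.\<close>

context
  fixes p x lam u w g b :: "'a::idom" and m :: nat
  assumes lam: "x ^ 2 * of_nat m * lam ^ 2 = (1 + x ^ 2 * (of_nat m - 1)) * lam - 1"
    and u: "u * (1 + x ^ 2 * (of_nat m - 1) - 2 * x ^ 2 * of_nat m * lam) = 1"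
  defines "w \<equiv> 1 - of_nat m + of_nat m * lam"
  defines "g \<equiv> lam * w"
  defines "b \<equiv> u * (1 + p * x * w)"
begin

lemma w_inverse: "w * (1 - x ^ 2 * of_nat m * lam) = 1"
  using lam unfolding w_def by algebra

text \<open>From \<open>Some d\<close> one either stops, with weight 1, or inserts a pair, with
  weight \<open>x ^ 2\<close>. Subtracting the equations for consecutive \<open>d\<close> removes
  the sum and leaves the quadratic for \<open>lam\<close>; the case \<open>d = 0\<close> determines
  \<open>g\<close>.\<close>

lemma high_weight_eq:
  "g * lam ^ d = 1 + x ^ 2 * (of_nat m * (g * lam ^ Suc d) + (\<Sum>i<Suc d. g * lam ^ i))"
proof (induction d)
  case 0
  have "g = 1 + x ^ 2 * (of_nat m * (g * lam) + g)"
    using lam w_inverse unfolding g_def by algebra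
  then show ?case by simp
next
  case (Suc d)
  have "g * (lam * y) - g * y =
      x ^ 2 * (of_nat m * (g * (lam * (lam * y))) - of_nat m * (g * (lam * y)) + g * (lam * y))" for y
    using lam by algebra
  from this[of "lam ^ d"] have "g * lam ^ Suc d - g * lam ^ d =
      x ^ 2 * (of_nat m * (g * lam ^ Suc (Suc d)) - of_nat m * (g * lam ^ Suc d) + g * lam ^ Suc d)"
    unfolding power_Suc .
  moreover have "a' = 1 + x ^ 2 * (of_nat m * a'' + (S + a'))"
    if "a = 1 + x ^ 2 * (of_nat m * a' + S)" "a' - a = x ^ 2 * (of_nat m * a'' - of_nat m * a' + a')"
    for a a' a'' S using that by algebra
  ultimately show ?case unfolding sum.lessThan_Suc[of _ "Suc d"] using Suc by blast
qed

text \<open>From \<open>None\<close> at size \<open>m + d\<close> a new fixed point leads to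
  \<open>Some d\<close>, and \<open>m\<close> kinds of pairs keep \<open>None\<close> while the size
  grows by two. The remaining sum is the one in \<open>high_weight_eq\<close>; eliminating it leaves
  one relation between \<open>b\<close> and \<open>g\<close>, the same for all
  \<open>d\<close>.\<close>

lemma low_weight_eq:
  "b * lam ^ d = 1 + p * x * (g * lam ^ d) +
     x ^ 2 * (of_nat m * (b * lam ^ (d + 2)) + (\<Sum>i<Suc d. g * lam ^ i))"
proof -
  have "b * (1 - x ^ 2 * of_nat m * lam ^ 2) = g * (1 + p * x - x ^ 2 * of_nat m * lam)"
    using lam w_inverse u unfolding g_def b_def by algebra
  then have "b * y - x ^ 2 * of_nat m * (b * (y * lam ^ 2)) =
      p * x * (g * y) + (g * y - x ^ 2 * (of_nat m * (g * (lam * y))))" for y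
    by algebra
  from this[of "lam ^ d"] have "b * lam ^ d - x ^ 2 * of_nat m * (b * lam ^ (d + 2)) =
      p * x * (g * lam ^ d) + (g * lam ^ d - x ^ 2 * (of_nat m * (g * lam ^ Suc d)))"
    unfolding power_add power_Suc .
  moreover have "c = 1 + p * x * a + x ^ 2 * (of_nat m * c'' + S)"
    if "c - x ^ 2 * of_nat m * c'' = p * x * a + (a - x ^ 2 * (of_nat m * a'))"
      "a = 1 + x ^ 2 * (of_nat m * a' + S)"
    for c c'' a a' S using that by algebra
  ultimately show ?thesis using high_weight_eq[of d] by blast
qed

text \<open>The terms of size \<open>m + d + 1\<close> cancel. One insertion step expands the
  potential at size \<open>m + d\<close>; its pair part cancels against the recursion for size
  \<open>m + d + 2\<close>, and the fixed point parts against the corrections in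
  \<open>tail_series\<close>.\<close>

lemma wsum_eq_tail_series_diff:
  "wsum p m {..<m + d} (\<lambda>_. 1) = tail_series p m x lam g b d - x * tail_series p m x lam g b (Suc d)"
proof -
  let ?n = "m + d" and ?none = "\<lambda>q::nat option. if q = None then 1 else (0::'a)"
  let ?P = "\<lambda>q. case q of
        None \<Rightarrow> of_nat m * potential lam g b (d + 2) None + (\<Sum>i<Suc ?n - m. potential lam g b (d + 2) (Some i))
      | Some i \<Rightarrow> of_nat m * potential lam g b (d + 2) (Some (Suc i)) +
          (\<Sum>i<Suc i. potential lam g b (d + 2) (Some i))"
  have pot: "potential lam g b d = (\<lambda>q. x ^ 2 * ?P q + (1 + p * x * (g * lam ^ d) * ?none q))"
  proof
    fix q
    show "potential lam g b d q = x ^ 2 * ?P q + (1 + p * x * (g * lam ^ d) * ?none q)"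
    proof (cases q)
      case None
      with low_weight_eq[of d] show ?thesis by (simp add: potential_def algebra_simps)
    next
      case (Some i)
      with high_weight_eq[of i] show ?thesis by (simp add: potential_def del: sum.lessThan_Suc)
    qed
  qed
  have 1: "wsum p m {..<?n} (potential lam g b d) = x ^ 2 * wsum p m {..<?n} ?P +
      wsum p m {..<?n} (\<lambda>_. 1) + p * x * (g * lam ^ d) * wsum p m {..<?n} ?none"
    by (subst pot) (simp only: wsum_add wsum_cmult add.assoc)
  have 2: "wsum p m {..<?n + 2} (potential lam g b (d + 2)) =
      p * (g * lam ^ Suc d) * wsum p m {..<Suc ?n} ?none + wsum p m {..<?n} ?P"
    by (subst wsum_rec_Suc_Suc) (simp_all add: potential_def)
  show ?thesis
    unfolding tail_series_def using 1 2 by (simp add: algebra_simps power2_eq_square)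
qed

text \<open>Size \<open>m + 1\<close> equals \<open>l + 2\<close>, so one recursion step reduces it
  to sizes \<open>m\<close> and \<open>l\<close>, where no point is high. Its fixed point term
  cancels the correction.\<close>

lemma tail_series_0:
  assumes m: "m = Suc l"
  shows "tail_series p m x lam g b 0 =
    b * (\<Sum>w\<in>involutions m. p ^ fixpts w) +
    x * of_nat m * lam * b * (\<Sum>w\<in>involutions l. p ^ fixpts w)"
proof -
  have "wsum p m {..<l + 2} (potential lam g b 1) =
      p * g * (\<Sum>w\<in>involutions m. p ^ fixpts w) +
      of_nat m * (b * lam) * (\<Sum>w\<in>involutions l. p ^ fixpts w)"
    by (subst wsum_rec_Suc_Suc) (simp_all add: wsum_small potential_def m mult_ac)
  then show ?thesis
    by (simp add: tail_series_def wsum_small potential_def m algebra_simps)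
qed

lemma sum_wsum:
  "(\<Sum>d<N. wsum p m {..<m + d} (\<lambda>_. 1) * x ^ d) =
    tail_series p m x lam g b 0 - x ^ N * tail_series p m x lam g b N"
proof (induction N)
  case (Suc N)
  then show ?case by (simp only: sum.lessThan_Suc wsum_eq_tail_series_diff) (simp add: algebra_simps)
qed simp

end

text \<open>The coefficients of the power series root of
  \<open>m x\<^sup>2 \<lambda>\<^sup>2 - (1 + (m - 1) x\<^sup>2) \<lambda> + 1 = 0\<close>, whose discriminant is \<open>1 / u\<^sub>0\<^sup>2\<close>. The root is defined
  by recursion because polynomial coefficients do not form a field.\<close>

fun lam_coeff :: "nat \<Rightarrow> nat \<Rightarrow> 'a::comm_ring_1" where
  "lam_coeff m 0 = 1"
| "lam_coeff m (Suc 0) = 0"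
| "lam_coeff m (Suc (Suc n)) =
    of_nat m * (\<Sum>i\<le>n. lam_coeff m i * lam_coeff m (n - i)) - (of_nat m - 1) * lam_coeff m n"

lemma lam_fps:
  fixes lam :: "'a::comm_ring_1 fps" and m :: nat
  defines "lam \<equiv> Abs_fps (lam_coeff m)"
  shows "fps_X ^ 2 * of_nat m * lam ^ 2 = (1 + fps_X ^ 2 * (of_nat m - 1)) * lam - 1"
proof -
  have "fps_X ^ 2 * (fps_const (of_nat m) * lam ^ 2) =
      lam + fps_X ^ 2 * (fps_const (of_nat m - 1) * lam) - 1" (is "?l = ?r")
  proof (rule fps_ext)
    fix n
    show "?l $ n = ?r $ n"
      \<comment> \<open>The three defining equations are exactly the comparisons of the coefficients
        at 0, 1 and \<open>n + 2\<close>.\<close>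
      by (cases "(m, n)" rule: lam_coeff.cases)
        (simp_all add: lam_def fps_X_power_mult_nth power2_eq_square[of "Abs_fps _"] fps_mult_nth[of "Abs_fps _"]
          atLeast0AtMost)
  qed
  then show ?thesis
    by (simp add: fps_of_nat algebra_simps flip: fps_const_sub)
qed

text \<open>In an integral domain a square root is unique up to sign, and the constant term 1 fixes
  the sign; so the definite description in \<open>u0\<close> is well defined.\<close>

lemma u0_eqI:
  fixes u :: "real poly fps"
  assumes "u $ 0 = 1" "u ^ 2 * (1 - fps_const (2 * of_nat (k - 1)) * fps_X ^ 2
              + fps_const (of_nat ((k - 3) ^ 2)) * fps_X ^ 4) = 1"
  shows "u0 k = u"
  unfolding u0_def
proof (rule the_equality)
  fix v :: "real poly fps"
  assume v: "v $ 0 = 1 \<and> v ^ 2 * (1 - fps_const (2 * of_nat (k - 1)) * fps_X ^ 2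
              + fps_const (of_nat ((k - 3) ^ 2)) * fps_X ^ 4) = 1"
  have "v ^ 2 = v ^ 2 * (u ^ 2 * (1 - fps_const (2 * of_nat (k - 1)) * fps_X ^ 2
              + fps_const (of_nat ((k - 3) ^ 2)) * fps_X ^ 4))"
    by (simp only: assms(2) mult_1_right)
  also have "\<dots> = u ^ 2 * (v ^ 2 * (1 - fps_const (2 * of_nat (k - 1)) * fps_X ^ 2
              + fps_const (of_nat ((k - 3) ^ 2)) * fps_X ^ 4))"
    by (rule mult.left_commute)
  also have "\<dots> = u ^ 2" by (simp only: conjunct2[OF v] mult_1_right)
  finally have "v ^ 2 = u ^ 2" .
  moreover have "v \<noteq> - u"
  proof
    assume "v = - u"
    then have "(1::real poly) = - 1" using assms(1) v by (metis fps_neg_nth)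
    then show False by simp
  qed
  ultimately show "v = u" by (simp add: power2_eq_iff)
qed (use assms in simp)


section \<open>Assembling the closed form\<close>

lemma sum_pvar_power:
  "(\<Sum>w\<in>A. fps_const pvar ^ fixpts w) = fps_const (\<Sum>w\<in>A. pvar ^ fixpts w)"
  by (rule fps_ext) (simp add: fps_sum_nth)

theorem theorem1p1:
  fixes k :: nat
  assumes "k \<ge> 3"
  shows "fps_to_fls (gen_fun k) =
      fps_to_fls (\<Sum>j=0..k-3. fps_const (J j) * fps_X ^ j)
    - fls_X_intpow (int k - 3) * fls_const [:1/2:]
        * (fls_const pvar
           + (fls_const (pvar * of_nat (k - 3)) * fls_X ^ 2 - 2 * fls_X - fls_const pvar)
             * fps_to_fls (u0 k))
        * fls_const (J (k - 2))
    - fls_X_intpow (int k - 4) * fls_const [:1/2:]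
        * (fls_X + fls_const pvar
           - (fls_const (of_nat (k - 3)) * fls_X ^ 3 - fls_const (pvar * of_nat (k - 1)) * fls_X ^ 2
              + fls_X + fls_const pvar) * fps_to_fls (u0 k))
        * fls_const (J (k - 3))"
proof -
  define l where "l = k - 3"
  define m where "m = Suc l"
  have k: "k = m + 2" "k - 3 = l" "k - 2 = m" "k - 1 = l + 2" using assms by (auto simp: l_def m_def)
  define X p lam :: "real poly fps" where "X = fps_X" and "p = fps_const pvar"
    and "lam = Abs_fps (lam_coeff m)"
  define M L :: "real poly fps" where "M = of_nat m" and "L = of_nat l"
  have M: "M = L + 1" by (simp add: M_def L_def m_def)
  \<comment> \<open>The square of \<open>s\<close> is the discriminant, which is the radicand of
    \<open>u0\<close>; hence its inverse \<open>u\<close> is \<open>u0 k\<close>.\<close>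
  define s where "s = 1 + X ^ 2 * (M - 1) - 2 * X ^ 2 * M * lam"
  define u where "u = fps_right_inverse s 1"
  define w where "w = 1 - M + M * lam"
  define b where "b = u * (1 + p * X * w)"
  define T where "T = tail_series p m X lam (lam * w) b"
  have lam: "X ^ 2 * M * lam ^ 2 = (1 + X ^ 2 * (M - 1)) * lam - 1"
    unfolding X_def M_def lam_def by (rule lam_fps)
  have s0: "s $ 0 = 1" by (simp add: s_def X_def)
  then have us: "u * s = 1" unfolding u_def by (subst mult.commute) (rule fps_right_inverse, simp)
  have u: "u * (1 + X ^ 2 * (M - 1) - 2 * X ^ 2 * M * lam) = 1" using us by (simp add: s_def)
  have "u $ 0 * s $ 0 = 1" using us by (metis fps_mult_nth_0 fps_one_nth)
  then have u_nth_0: "u $ 0 = 1" using s0 by simp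

  have "s ^ 2 = 1 - 2 * (L + 2) * X ^ 2 + L ^ 2 * X ^ 4"
    using lam unfolding s_def M by algebra
  then have "u ^ 2 * (1 - 2 * (L + 2) * X ^ 2 + L ^ 2 * X ^ 4) = 1"
    using us by algebra
  moreover have "fps_const (2 * of_nat (k - 1)) = 2 * (L + 2)"
    using fps_of_nat[of "2 * (l + 2)", where ?'a = "real poly"] unfolding k(2-4) L_def by simp
  moreover have "fps_const (of_nat ((k - 3) ^ 2)) = L ^ 2"
    unfolding k(2-4) L_def fps_of_nat by simp
  ultimately have u0: "u0 k = u" by (intro u0_eqI u_nth_0) (simp add: X_def)

  have lw: "X ^ 2 * lam * w = lam - 1" using lam unfolding w_def by algebra
  \<comment> \<open>Both brackets of the claim are multiples of \<open>b\<close>, like the two terms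
    of \<open>T 0\<close>. The auxiliary identities are multiplied by \<open>u\<close>, where
    \<open>u * s = 1\<close>.\<close>
  have A: "p + (p * L * X ^ 2 - 2 * X - p) * u = - 2 * X * b"
  proof -
    have "s + L * X ^ 2 - 1 + 2 * X ^ 2 * w = 0" unfolding s_def w_def M by algebra
    with us show ?thesis unfolding b_def by algebra
  qed
  have B: "X + p - (L * X ^ 3 - p * (L + 2) * X ^ 2 + X + p) * u = - 2 * X ^ 3 * M * lam * b"
  proof -
    have "s - X ^ 2 * L - 1 + 2 * X ^ 2 * M * lam = 0"
      unfolding s_def M by algebra
    moreover have "s + X ^ 2 * (L + 2) - 1 + 2 * X ^ 4 * M * lam * w = 0"
      using lw unfolding s_def M by algebra
    ultimately show ?thesis using us unfolding b_def by algebra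
  qed

  have coeff: "wsum p m {..<n} (\<lambda>_. 1) = fps_const (gen_fun k $ n)" for n
    unfolding gen_fun_def k(1) p_def sum_invols_avoiding[symmetric] sum_pvar_power by simp
  have J: "(\<Sum>w\<in>involutions n. p ^ fixpts w) = fps_const (J n)" for n
    unfolding p_def J_def by (rule sum_pvar_power)
  have gen: "gen_fun k = (\<Sum>j<m. fps_const (J j) * X ^ j) + X ^ m * T 0"
  proof (rule fps_ext)
    fix n
    have small: "fps_const (gen_fun k $ j) = fps_const (J j)" if "j < m" for j
      using coeff[of j] wsum_small[of j m p "\<lambda>_. 1"] J[of j] that by simp
    \<comment> \<open>Terms beyond index \<open>m + n\<close> do not affect coefficient
      \<open>n\<close>, and neither does the remainder of the telescoped sum, which is divisible by
      \<open>X ^ (m + Suc n)\<close>.\<close>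
    have "gen_fun k $ n = (\<Sum>j<m + Suc n. fps_const (gen_fun k $ j) * X ^ j) $ n"
      by (simp add: fps_sum_nth X_def if_distrib[of "(*) _"] cong: if_cong)
    also have "(\<Sum>j<m + Suc n. fps_const (gen_fun k $ j) * X ^ j) =
        (\<Sum>j<m. fps_const (gen_fun k $ j) * X ^ j) +
        (\<Sum>d<Suc n. fps_const (gen_fun k $ (m + d)) * X ^ (m + d))"
      by (induction n) (simp_all add: add.assoc)
    also have "(\<Sum>d<Suc n. fps_const (gen_fun k $ (m + d)) * X ^ (m + d)) =
        X ^ m * (\<Sum>d<Suc n. wsum p m {..<m + d} (\<lambda>_. 1) * X ^ d)"
      by (simp only: coeff sum_distrib_left power_add mult.left_commute)
    also have "\<dots> = X ^ m * (T 0 - X ^ Suc n * T (Suc n))"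
      unfolding T_def b_def w_def M_def
      by (subst sum_wsum[OF lam[unfolded M_def] u[unfolded M_def]]) simp
    also have "(\<Sum>j<m. fps_const (gen_fun k $ j) * X ^ j) = (\<Sum>j<m. fps_const (J j) * X ^ j)"
      using small by simp
    also have "X ^ m * (T 0 - X ^ Suc n * T (Suc n)) = X ^ m * T 0 - X ^ (m + Suc n) * T (Suc n)"
      by (simp add: algebra_simps power_add)
    finally show "gen_fun k $ n = ((\<Sum>j<m. fps_const (J j) * X ^ j) + X ^ m * T 0) $ n"
      by (simp add: X_def fps_X_power_mult_nth del: power_Suc add_Suc_right)
  qed
  have T0: "T 0 = b * fps_const (J m) + X * M * lam * b * fps_const (J l)"
    unfolding T_def b_def w_def M_def
    by (subst tail_series_0[OF lam[unfolded M_def] u[unfolded M_def] m_def]) (simp add: J)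

  define h :: "real poly fps" where "h = fps_const [:1/2:]"
  have h: "2 * h = 1" by (simp add: h_def fps_numeral_fps_const numeral_poly)
  \<comment> \<open>\<open>B'\<close> is the second bracket divided by \<open>X\<close>. For
    \<open>k = 3\<close> the prefactor has exponent -1, and this factor \<open>X\<close> compensates
    for it.\<close>
  define A' B' where "A' = p + (p * L * X ^ 2 - 2 * X - p) * u"
    and "B' = - 2 * X ^ 2 * M * lam * b"
  have gen': "gen_fun k = (\<Sum>j=0..k-3. fps_const (J j) * X ^ j)
      - X ^ l * h * A' * fps_const (J m) - X ^ l * h * B' * fps_const (J l)"
  proof -
    have "{0..k - 3} = {..<m}" by (auto simp: k m_def)
    moreover have "X * y * (b * c + X * M * lam * b * c') =
        - (y * h * (- 2 * X * b) * c) - y * h * (- 2 * X ^ 2 * M * lam * b) * c'" for y c c'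
      using h by algebra
    then have "X ^ m * T 0 = - (X ^ l * h * A' * fps_const (J m)) - X ^ l * h * B' * fps_const (J l)"
      unfolding T0 m_def A'_def A B'_def power_Suc .
    ultimately show ?thesis unfolding gen by simp
  qed
  have ints: "int k - 3 = int l" "int k - 4 + 1 = int l" using k by simp_all
  have X_l: "fps_to_fls (X ^ l) = fls_X_intpow (int l)"
    unfolding X_def fps_to_fls_power fps_X_to_fls by (rule fls_X_power_conv_shift_1)
  then have pow1: "fls_X_intpow (int k - 3) = fps_to_fls (X ^ l)" by (simp only: ints)
  have "fls_X_intpow (int k - 4) * fps_to_fls X = fls_X_intpow (int k - 4 + 1)"
    unfolding X_def fps_X_to_fls fls_X_conv_shift_1 by (rule fls_X_intpow_times_fls_X_intpow)
  then have pow2: "fls_X_intpow (int k - 4) * fps_to_fls X = fps_to_fls (X ^ l)"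
    by (simp only: ints X_l)
  have constL: "fls_const (of_nat l) = fps_to_fls L"
     "fls_const (pvar * of_nat l) = fps_to_fls (p * L)"
     "fls_const (pvar * of_nat (l + 2)) = fps_to_fls (p * (L + 2))"
  proof -
    have L: "L = fps_const (of_nat l)" "L + 2 = fps_const (of_nat (l + 2))"
      unfolding L_def fps_of_nat by simp_all
    show "fls_const (of_nat l) = fps_to_fls L"
     "fls_const (pvar * of_nat l) = fps_to_fls (p * L)"
      unfolding L(1) p_def fps_const_mult fps_const_to_fls by (rule refl)+
    show "fls_const (pvar * of_nat (l + 2)) = fps_to_fls (p * (L + 2))"
      unfolding L(2) p_def fps_const_mult fps_const_to_fls by (rule refl)
  qed
  have A'_fls: "fls_const pvar
           + (fls_const (pvar * of_nat l) * fls_X ^ 2 - 2 * fls_X - fls_const pvar)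
             * fps_to_fls (u0 k) = fps_to_fls A'"
    unfolding constL u0 A'_def X_def p_def
    by (simp add: fls_times_fps_to_fls fps_to_fls_power)
  have B'_fls: "fls_X + fls_const pvar
           - (fls_const (of_nat l) * fls_X ^ 3 - fls_const (pvar * of_nat (l + 2)) * fls_X ^ 2
              + fls_X + fls_const pvar) * fps_to_fls (u0 k) = fps_to_fls X * fps_to_fls B'"
  proof -
    have "fps_to_fls X * fps_to_fls B' =
       fps_to_fls (X + p - (L * X ^ 3 - p * (L + 2) * X ^ 2 + X + p) * u)"
      unfolding B B'_def fls_times_fps_to_fls[symmetric] by (simp add: eval_nat_numeral)
    then show ?thesis
      unfolding constL u0 X_def p_def
      by (simp add: fls_times_fps_to_fls fps_to_fls_power)
  qed
  have pow: "fls_X_intpow (int k - 4) * fls_const [:1/2:] * (fps_to_fls X * fps_to_fls B') * c =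
      fps_to_fls (X ^ l) * fls_const [:1/2:] * fps_to_fls B' * c" for c
    unfolding pow2[symmetric] by (simp only: mult_ac)
  show ?thesis
    unfolding k(2-4) A'_fls B'_fls pow pow1 gen' X_def[symmetric]
    by (simp only: fps_to_fls_minus fls_times_fps_to_fls h_def fps_const_to_fls k(2))
qed

end
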